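(* Let $G$ be a finite group and $\alpha\geq 1$. If $A,B\subset G$ are non-empty subsets with $e(A,B)\geq\alpha^{-1}$, then there exist constants $\beta_1,\beta_2,\beta_3,\beta_4\geq 1$ with $$\beta_1\leq 2^{1861}\alpha^{720},\quad \beta_2\leq 2^{325}\alpha^{126},\quad\beta_3\leq 2^{2424}\alpha^{937},\quad \beta_4\leq 2^{930}\alpha^{360},$$ a $\beta_1$-approximate subgroup $\tilde H\subset G$ and elements $x,y\in G$ such that $$|\tilde H|\leq\beta_2|A|\leq\beta_2\alpha^2|B|,\qquad |A\cap x\tilde H|\geq\beta_3^{-1}|A|,\qquad |B\cap\tilde H y|\geq\beta_3^{-1}|B|,\qquad \frac{|\tilde H\cdot\tilde H\cdot\tilde H|}{|\tilde H|}\leq\beta_4.$$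
   Context: For subsets $A,B$ of a finite group $G$, the multiplicative energy is $E(A,B)=|\{(a_1,a_2,b_1,b_2)\in A^2\times B^2: a_1b_1=a_2b_2\}|$ and the normalized energy is $e(A,B)=E(A,B)/(|A||B|)^{3/2}$. For $\beta\geq 1$, a subset $\tilde H\subset G$ is a $\beta$-approximate subgroup if $1\in\tilde H$, $\tilde H=\tilde H^{-1}$, and there is a symmetric subset $X\subset\tilde H\cdot\tilde H$ with $|X|\leq\beta$ and $\tilde H\cdot\tilde H\subset X\cdot\tilde H$. *)

theory Defs
  imports Complex_Main "HOL-Algebra.Coset"
begin

definition mult_energy :: "('a, 'b) monoid_scheme \<Rightarrow> 'a set \<Rightarrow> 'a set \<Rightarrow> nat" where
  "mult_energy G A B =
    card {(a1, a2, b1, b2). a1 \<in> A \<and> a2 \<in> A \<and> b1 \<in> B \<and> b2 \<in> B \<and>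
                            a1 \<otimes>\<^bsub>G\<^esub> b1 = a2 \<otimes>\<^bsub>G\<^esub> b2}"

definition normalized_energy :: "('a, 'b) monoid_scheme \<Rightarrow> 'a set \<Rightarrow> 'a set \<Rightarrow> real" where
  "normalized_energy G A B =
    real (mult_energy G A B) / (real (card A) * real (card B)) powr (3 / 2)"

(* Finiteness of X is automatic in a finite group; it is required explicitly because
   card is 0 on infinite sets. *)
definition approximate_subgroup :: "('a, 'b) monoid_scheme \<Rightarrow> real \<Rightarrow> 'a set \<Rightarrow> bool" where
  "approximate_subgroup G \<beta> H \<longleftrightarrow>
     1 \<le> \<beta> \<and> H \<subseteq> carrier G \<and> \<one>\<^bsub>G\<^esub> \<in> H \<and> H = set_inv\<^bsub>G\<^esub> H \<and>
     (\<exists>X. finite X \<and> X \<subseteq> H <#>\<^bsub>G\<^esub> H \<and> X = set_inv\<^bsub>G\<^esub> X \<and> real (card X) \<le> \<beta> \<and>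
          H <#>\<^bsub>G\<^esub> H \<subseteq> X <#>\<^bsub>G\<^esub> H)"

end

theory Submission
  imports Defs "HOL-Library.Disjoint_Sets"
begin

text \<open>
  High energy makes the bipartite graph of pairs \<open>(a, b)\<close> whose product is popular dense. The
  Balog--Szemeredi--Gowers argument finds large \<open>P \<subseteq> A\<close>, \<open>Q \<subseteq> B\<close> all of whose pairs are joined by
  many paths of length three, which bounds \<open>|P Q|\<close>, and the Ruzsa triangle inequality then bounds
  \<open>|P P\<inverse>| \<le> K |P|\<close>. Let \<open>S\<close> be the set of elements with at least \<open>|P| / 2K\<close> representations
  \<open>x\<inverse> y\<close> in \<open>P\<close>. Writing \<open>p s y = (p x\<inverse>) (z y)\<close> for \<open>s = x\<inverse> z\<close> gives \<open>|P S Y| \<le> 2 K\<^sup>2 |P Y|\<close> for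
  every \<open>Y\<close>, so all powers of \<open>S\<close>, and also \<open>S Q\<close>, are small. Hence \<open>H = S S\<close> is an approximate
  subgroup by covering, and the translates are found by pigeonhole.
\<close>

section \<open>Double counting over the fibres of a map\<close>

lemma sum_card_swap:
  assumes "finite S" "finite T"
  shows "(\<Sum>x\<in>S. real (card {y\<in>T. R x y})) = (\<Sum>y\<in>T. real (card {x\<in>S. R x y}))"
proof -
  have "(\<Sum>x\<in>S. card {y\<in>T. R x y}) = (\<Sum>y\<in>T. card {x\<in>S. R x y})"
    by (rule sum_multicount_gen) (use assms in auto)
  then show ?thesis
    by (simp flip: of_nat_sum)
qed

text \<open>Fibres over distinct \<open>t\<close> are disjoint. This serves to bound product sets
  from above: it is enough to give each element of \<open>T\<close> many representations by elements
  of \<open>Z\<close>.\<close>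

lemma card_le_by_fibers:
  fixes c :: real
  assumes "finite Z" "finite T" and c: "\<And>t. t \<in> T \<Longrightarrow> c \<le> card {z\<in>Z. f z = t}"
  shows "c * card T \<le> card Z"
proof -
  have "c * card T = (\<Sum>t\<in>T. c)"
    by simp
  also have "\<dots> \<le> (\<Sum>t\<in>T. real (card {z\<in>Z. f z = t}))"
    by (rule sum_mono) (rule c)
  also have "\<dots> = (\<Sum>z\<in>Z. real (card {t\<in>T. f z = t}))"
    by (rule sum_card_swap) (use assms in auto)
  also have "\<dots> \<le> (\<Sum>z\<in>Z. 1)"
  proof (rule sum_mono)
    fix z show "real (card {t\<in>T. f z = t}) \<le> 1"
      using card_mono[of "{f z}" "{t\<in>T. f z = t}"] by auto
  qed
  finally show ?thesis by simp
qed

lemma sum_fibers: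
  assumes "finite Z" "finite W" "f ` Z \<subseteq> W"
  shows "(\<Sum>w\<in>W. real (card {z\<in>Z. f z = w})) = card Z"
proof -
  have "{w\<in>W. f z = w} = {f z}" if "z \<in> Z" for z
    using assms that by auto
  then show ?thesis
    using sum_card_swap[OF assms(2,1), of "\<lambda>w z. f z = w"] by simp
qed

text \<open>Pigeonhole: if every fibre were below the mean, the fibres could not add up to
  \<open>card Z\<close>. It later produces the translates.\<close>

lemma large_fiber:
  assumes "finite Z" "finite W" "f ` Z \<subseteq> W" "W \<noteq> {}"
  obtains w where "w \<in> W" "card Z \<le> real (card W) * card {z\<in>Z. f z = w}"
proof -
  have "\<exists>w\<in>W. card Z \<le> real (card W) * card {z\<in>Z. f z = w}"
  proof (rule ccontr)
    assume "\<not> ?thesis"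
    then have "(\<Sum>w\<in>W. real (card W) * card {z\<in>Z. f z = w}) < (\<Sum>w\<in>W. real (card Z))"
      using assms by (intro sum_strict_mono) auto
    then show False
      using sum_fibers[OF assms(1-3)] by (simp flip: sum_distrib_left)
  qed
  then show ?thesis using that by blast
qed

text \<open>Cauchy--Schwarz for fibre sizes: grouped by the value of \<open>f\<close>, the sum on
  the right becomes the sum over \<open>W\<close> of the squared fibre sizes.\<close>

lemma sum_fibers_squared:
  assumes "finite Z" "finite W" "f ` Z \<subseteq> W"
  shows "(real (card Z))\<^sup>2 \<le> real (card W) * (\<Sum>z\<in>Z. real (card {z'\<in>Z. f z' = f z}))"
proof (cases "W = {}")
  case True
  then show ?thesis using assms by auto
next
  case False
  let ?r = "\<lambda>w. real (card {z\<in>Z. f z = w})"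
  \<comment> \<open>The mean fibre size. At this \<open>c\<close>, summing
    \<open>2 * c * r - c\<^sup>2 \<le> r\<^sup>2\<close> over \<open>W\<close> gives exactly the
    Cauchy--Schwarz bound.\<close>
  define c where "c = real (card Z) / card W"
  have W: "real (card W) > 0" using False assms by (simp add: card_gt_0_iff)
  have "(\<Sum>z\<in>Z. ?r (f z)) = (\<Sum>w\<in>W. \<Sum>z\<in>{z\<in>Z. f z = w}. ?r (f z))"
    using sum.group[OF assms, of "\<lambda>z. ?r (f z)"] by simp
  also have "\<dots> = (\<Sum>w\<in>W. (?r w)\<^sup>2)"
    by (rule sum.cong) (auto simp: power2_eq_square)
  also have "\<dots> \<ge> (\<Sum>w\<in>W. 2 * c * ?r w - c\<^sup>2)"
  proof (rule sum_mono)
    fix w show "2 * c * ?r w - c\<^sup>2 \<le> (?r w)\<^sup>2"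
      using zero_le_power2[of "?r w - c"] by (simp add: power2_diff algebra_simps)
  qed
  also have "(\<Sum>w\<in>W. 2 * c * ?r w - c\<^sup>2) = 2 * c * card Z - card W * c\<^sup>2"
    using sum_fibers[OF assms] by (simp add: sum_subtractf flip: sum_distrib_left)
  also have "\<dots> = (real (card Z))\<^sup>2 / card W"
    using W by (simp add: c_def power2_eq_square field_simps)
  finally show ?thesis
    using W by (simp add: field_simps)
qed

text \<open>Elements with \<open>f x < t\<close> contribute at most \<open>t * card X\<close> in
  total, so the rest of the sum comes from popular elements, each worth at most
  \<open>M\<close>.\<close>

lemma card_popular_ge:
  fixes f :: "'a \<Rightarrow> real" and t :: real
  assumes "finite X" and M: "\<And>x. x \<in> X \<Longrightarrow> f x \<le> M"
  assumes t: "t \<ge> 0"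
  shows "sum f X - t * card X \<le> M * card {x\<in>X. t \<le> f x}"
proof -
  let ?Y = "{x\<in>X. t \<le> f x}"
  have "sum f X = sum f ?Y + sum f (X - ?Y)"
    using assms(1) by (subst sum.subset_diff[of ?Y]) auto
  also have "sum f ?Y \<le> of_nat (card ?Y) * M"
    by (rule sum_bounded_above) (use M in auto)
  also have "sum f (X - ?Y) \<le> of_nat (card (X - ?Y)) * t"
    by (rule sum_bounded_above) auto
  also have "of_nat (card (X - ?Y)) * t \<le> card X * t"
    using assms by (intro mult_right_mono) (auto intro: card_mono)
  finally show ?thesis by (simp add: algebra_simps)
qed

section \<open>Paths of length three in dense bipartite graphs\<close>

text \<open>Vertices of low degree are dropped, and a vertex \<open>b0\<close> is chosen whose
  neighbourhood \<open>U\<close> is large and contains few pairs with few common neighbours.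
  \<open>A'\<close> consists of the members of \<open>U\<close> in few such bad pairs,
  \<open>B'\<close> of the vertices with many neighbours in \<open>U\<close>. A path from
  \<open>a\<close> to \<open>b\<close> is built by choosing a neighbour \<open>u\<close> of
  \<open>b\<close> in \<open>U\<close> that is not bad with \<open>a\<close>, then a common
  neighbour \<open>v\<close> of \<open>a\<close> and \<open>u\<close>.\<close>

lemma balog_szemeredi_gowers_graph:
  fixes \<delta> :: real
  assumes fin: "finite A" "finite B" and ne: "A \<noteq> {}" "B \<noteq> {}"
    and E: "E \<subseteq> A \<times> B" and \<delta>: "\<delta> > 0" and dense: "\<delta> * card A * card B \<le> card E"
  obtains A' B' where "A' \<subseteq> A" "B' \<subseteq> B" "\<delta> / 6 * card A \<le> card A'" "\<delta> / 4 * card B \<le> card B'"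
    "\<forall>a\<in>A'. \<forall>b\<in>B'. \<delta> ^ 5 / 2 ^ 12 * card A * card B
       \<le> card {(u, v). u \<in> A \<and> v \<in> B \<and> (a, v) \<in> E \<and> (u, v) \<in> E \<and> (u, b) \<in> E}"
proof -
  define m n where "m = real (card A)" and "n = real (card B)"
  have m: "m > 0" and n: "n > 0"
    using fin ne by (simp_all add: m_def n_def card_gt_0_iff)
  define deg where "deg a = real (card {b\<in>B. (a, b) \<in> E})" for a
  define A0 where "A0 = {a\<in>A. \<delta> / 2 * n \<le> deg a}"
  define N where "N b = {a\<in>A0. (a, b) \<in> E}" for b
  have A0: "A0 \<subseteq> A" "finite A0" using fin by (auto simp: A0_def)
  have finN: "finite (N b)" for b using A0 by (simp add: N_def)
  have "real (card E) = sum deg A"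
  proof -
    have "E = Sigma A (\<lambda>a. {b\<in>B. (a, b) \<in> E})" using E by auto
    then have "card E = (\<Sum>a\<in>A. card {b\<in>B. (a, b) \<in> E})"
      using fin card_SigmaI[of A "\<lambda>a. {b\<in>B. (a, b) \<in> E}"] by simp
    then show ?thesis by (simp add: deg_def)
  qed
  also have "\<dots> = sum deg A0 + sum deg (A - A0)"
    using A0 fin by (simp add: sum.subset_diff add.commute)
  also have "sum deg (A - A0) \<le> of_nat (card (A - A0)) * (\<delta> / 2 * n)"
    by (rule sum_bounded_above) (auto simp: A0_def)
  also have "\<dots> \<le> m * (\<delta> / 2 * n)"
    using fin n \<delta> by (intro mult_right_mono) (auto intro: card_mono simp: m_def)
  finally have e0: "\<delta> / 2 * m * n \<le> sum deg A0"
    using dense by (simp add: m_def n_def algebra_simps)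
  have sumN: "(\<Sum>b\<in>B. real (card (N b))) = sum deg A0"
    unfolding deg_def N_def by (rule sum_card_swap) (use A0 fin in auto)
  \<comment> \<open>By \<open>e0\<close> this is a lower bound for the mean of
    \<open>card (N b)\<close>; the bound \<open>sq\<close> on the second moment then follows from
    \<open>2 * c * r - c\<^sup>2 \<le> r\<^sup>2\<close>.\<close>
  define c where "c = \<delta> * m / 2"
  have c: "c > 0" using \<delta> m by (simp add: c_def)
  have "c\<^sup>2 * n \<le> 2 * c * sum deg A0 - c\<^sup>2 * n"
  proof -
    have "c * (c * n) \<le> c * sum deg A0"
      using e0 c by (intro mult_left_mono) (auto simp: c_def)
    then show ?thesis by (simp add: power2_eq_square)
  qed
  also have "\<dots> = (\<Sum>b\<in>B. 2 * c * card (N b) - c\<^sup>2)"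
    by (simp add: sum_subtractf n_def sum_distrib_left mult.commute[of "c\<^sup>2"] flip: sumN)
  also have "\<dots> \<le> (\<Sum>b\<in>B. (real (card (N b)))\<^sup>2)"
  proof (rule sum_mono)
    fix b show "2 * c * card (N b) - c\<^sup>2 \<le> (real (card (N b)))\<^sup>2"
      using zero_le_power2[of "card (N b) - c"] by (simp add: power2_diff algebra_simps)
  qed
  finally have sq: "c\<^sup>2 * n \<le> (\<Sum>b\<in>B. (real (card (N b)))\<^sup>2)" .

  \<comment> \<open>With this threshold the bad pairs, weighted by \<open>16 / \<delta>\<close>,
    cost at most \<open>n * (\<delta>\<^sup>2 * m\<^sup>2 / 8)\<close> in total, which is half of
    \<open>c\<^sup>2 * n\<close>. The weight is the one that yields \<open>badU\<close>.\<close>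
  define \<eta> where "\<eta> = \<delta> ^ 3 / 128"
  define common where "common x = {b\<in>B. (fst x, b) \<in> E \<and> (snd x, b) \<in> E}" for x
  define Bad where "Bad = {x \<in> A0 \<times> A0. card (common x) < \<eta> * n}"
  define bad where "bad b = {x \<in> Bad. (fst x, b) \<in> E \<and> (snd x, b) \<in> E}" for b
  have Bad: "finite Bad" "real (card Bad) \<le> m\<^sup>2"
  proof -
    have *: "Bad \<subseteq> A \<times> A" using A0 by (auto simp: Bad_def)
    then show "finite Bad" using fin by (meson finite_SigmaI finite_subset)
    have "card Bad \<le> card A * card A"
      using card_mono[OF _ *] fin by (simp add: card_cartesian_product)
    then show "real (card Bad) \<le> m\<^sup>2"
      unfolding m_def power2_eq_square by (simp flip: of_nat_mult)
  qed
  have "(\<Sum>b\<in>B. real (card (bad b))) = (\<Sum>x\<in>Bad. real (card (common x)))"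
    unfolding bad_def common_def by (rule sum_card_swap) (use Bad fin in auto)
  also have "\<dots> \<le> of_nat (card Bad) * (\<eta> * n)"
    by (rule sum_bounded_above) (auto simp: Bad_def)
  also have "\<dots> \<le> m\<^sup>2 * (\<eta> * n)"
    using Bad \<delta> n by (intro mult_right_mono) (auto simp: \<eta>_def)
  finally have sumbad: "(\<Sum>b\<in>B. real (card (bad b))) \<le> m\<^sup>2 * (\<eta> * n)" .
  \<comment> \<open>Averaging over \<open>b\<close>: some neighbourhood is large and contains few bad pairs.\<close>
  have "\<exists>b\<in>B. \<delta>\<^sup>2 * m\<^sup>2 / 8 \<le> (real (card (N b)))\<^sup>2 - 16 / \<delta> * card (bad b)"
  proof (rule ccontr)
    assume "\<not> ?thesis"
    then have "(\<Sum>b\<in>B. (real (card (N b)))\<^sup>2 - 16 / \<delta> * card (bad b)) < (\<Sum>b\<in>B. \<delta>\<^sup>2 * m\<^sup>2 / 8)"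
      using fin ne by (intro sum_strict_mono) auto
    then have "(\<Sum>b\<in>B. (real (card (N b)))\<^sup>2) - 16 / \<delta> * (\<Sum>b\<in>B. real (card (bad b))) < n * (\<delta>\<^sup>2 * m\<^sup>2 / 8)"
      by (simp add: sum_subtractf sum_distrib_left n_def)
    moreover have "16 / \<delta> * (\<Sum>b\<in>B. real (card (bad b))) \<le> 16 / \<delta> * (m\<^sup>2 * (\<eta> * n))"
      using sumbad \<delta> by (intro mult_left_mono) auto
    moreover have "16 / \<delta> * (m\<^sup>2 * (\<eta> * n)) = n * (\<delta>\<^sup>2 * m\<^sup>2 / 8)"
      using \<delta> by (simp add: \<eta>_def power2_eq_square power3_eq_cube)
    moreover have "c\<^sup>2 * n = 2 * (n * (\<delta>\<^sup>2 * m\<^sup>2 / 8))"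
      by (simp add: c_def power2_eq_square)
    \<comment> \<open>The contradiction is purely linear and is stated over plain variables:
      \<open>s\<close> is the second moment, \<open>x\<close> the weighted bad pairs,
      \<open>w\<close> the lower bound \<open>c\<^sup>2 * n\<close>.\<close>
    moreover have "s - x < y \<Longrightarrow> x \<le> z \<Longrightarrow> z = y \<Longrightarrow> w = 2 * y \<Longrightarrow> w \<le> s \<Longrightarrow> False" for s x y z w :: real
      by linarith
    ultimately show False using sq by blast
  qed
  then obtain b0 where b0: "\<delta>\<^sup>2 * m\<^sup>2 / 8 \<le> (real (card (N b0)))\<^sup>2 - 16 / \<delta> * card (bad b0)"
    by blast
  define U where "U = N b0"
  define k where "k = real (card U)"
  have U: "U \<subseteq> A0" "finite U" using finN by (auto simp: U_def N_def)
  have "0 \<le> 16 / \<delta> * card (bad b0)" using \<delta> by simp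
  then have "\<delta>\<^sup>2 * m\<^sup>2 / 8 \<le> k\<^sup>2"
    using b0 unfolding k_def U_def by linarith
  \<comment> \<open>1/3 is a rational replacement for the square root of 1/8.\<close>
  moreover have "(\<delta> * m / 3)\<^sup>2 = \<delta>\<^sup>2 * m\<^sup>2 / 9"
    by (simp add: power_mult_distrib power_divide)
  ultimately have "(\<delta> * m / 3)\<^sup>2 \<le> k\<^sup>2"
    using zero_le_power2[of k] by linarith
  then have k: "\<delta> * m / 3 \<le> k"
    by (rule power2_le_imp_le) (simp add: k_def)
  then have kpos: "k > 0" using \<delta> m by (smt (verit) divide_pos_pos mult_pos_pos)
  have badU: "card (bad b0) \<le> \<delta> / 16 * k\<^sup>2"
  proof -
    have "16 / \<delta> * card (bad b0) \<le> k\<^sup>2"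
      using b0 mult_nonneg_nonneg[OF zero_le_power2 zero_le_power2, of \<delta> m]
      unfolding k_def U_def by linarith
    then show ?thesis using \<delta> by (simp add: field_simps mult_ac)
  qed
  define badn where "badn a = real (card {u\<in>U. (a, u) \<in> Bad})" for a
  \<comment> \<open>By \<open>badU\<close> the mean of \<open>badn\<close> over \<open>U\<close> is
    at most \<open>\<delta> / 16 * k\<close>. Cutting at twice this value keeps at least half of
    \<open>U\<close>.\<close>
  define A' where "A' = {a\<in>U. badn a \<le> \<delta> / 8 * k}"
  have sumbadn: "sum badn U = card (bad b0)"
  proof -
    have "bad b0 = Sigma U (\<lambda>a. {u\<in>U. (a, u) \<in> Bad})"
      by (auto simp: bad_def U_def N_def Bad_def)
    then show ?thesis using U by (simp add: badn_def)
  qed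
  have A': "k / 2 \<le> card A'"
  proof -
    have "of_nat (card (U - A')) * (\<delta> / 8 * k) \<le> sum badn (U - A')"
      by (rule sum_bounded_below) (auto simp: A'_def)
    also have "\<dots> \<le> sum badn U"
      using U by (intro sum_mono2) (auto simp: badn_def)
    also have "\<dots> \<le> (k / 2) * (\<delta> / 8 * k)"
      using badU by (simp add: sumbadn power2_eq_square mult_ac)
    finally have "real (card (U - A')) \<le> k / 2"
      using \<delta> kpos by (simp add: mult_le_cancel_right)
    moreover have "card A' + card (U - A') = card U"
      using U card_Diff_subset[of A' U] card_mono[of U A'] finite_subset[of A' U] by (auto simp: A'_def)
    ultimately show ?thesis by (simp add: k_def flip: of_nat_add)
  qed
  define degU where "degU b = real (card {u\<in>U. (u, b) \<in> E})" for b
  \<comment> \<open>Members of \<open>U\<close> have degree at least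
    \<open>\<delta> / 2 * n\<close>, so the mean of \<open>degU\<close> over \<open>B\<close> is at
    least \<open>\<delta> / 2 * k\<close>; the threshold is half of that.\<close>
  define B' where "B' = {b\<in>B. \<delta> / 4 * k \<le> degU b}"
  have B': "\<delta> / 4 * n \<le> card B'"
  proof -
    have "k * (\<delta> / 2 * n) = of_nat (card U) * (\<delta> / 2 * n)" by (simp add: k_def)
    also have "\<dots> \<le> sum deg U"
      by (rule sum_bounded_below) (use U in \<open>auto simp: A0_def\<close>)
    also have "\<dots> = sum degU B"
      unfolding deg_def degU_def by (rule sum_card_swap) (use U fin in auto)
    finally have "k * (\<delta> / 2 * n) - \<delta> / 4 * k * n \<le> sum degU B - \<delta> / 4 * k * n"
      by (rule diff_right_mono)
    also have "\<dots> \<le> k * card B'"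
      unfolding B'_def n_def
      by (rule card_popular_ge) (use fin U \<delta> kpos in \<open>auto simp: degU_def k_def intro: card_mono\<close>)
    finally have "k * (\<delta> / 4 * n) \<le> k * card B'" by (simp add: algebra_simps)
    then show ?thesis using kpos by simp
  qed
  have "\<delta> ^ 5 / 2 ^ 12 * card A * card B
       \<le> card {(u, v). u \<in> A \<and> v \<in> B \<and> (a, v) \<in> E \<and> (u, v) \<in> E \<and> (u, b) \<in> E}" (is "_ \<le> real (card ?P)")
    if ab: "a \<in> A'" "b \<in> B'" for a b
  proof -
    \<comment> \<open>At least \<open>\<delta> / 4 * k\<close> neighbours of \<open>b\<close> remain
      after at most \<open>\<delta> / 8 * k\<close> bad partners of \<open>a\<close> are removed, up
      to that loss.\<close>
    define V where "V = {u\<in>U. (u, b) \<in> E} - {u\<in>U. (a, u) \<in> Bad}"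
    have a: "a \<in> A0" "badn a \<le> \<delta> / 8 * k" and b: "\<delta> / 4 * k \<le> degU b"
      using ab U by (auto simp: A'_def B'_def)
    have "degU b - badn a \<le> card V"
      unfolding degU_def badn_def V_def
      using diff_card_le_card_Diff[of "{u\<in>U. (a, u) \<in> Bad}" "{u\<in>U. (u, b) \<in> E}"] U by simp
    then have V: "\<delta> / 8 * k \<le> card V" using a b by linarith
    have finV: "finite V" using U by (simp add: V_def)
    have "\<delta> / 8 * (\<delta> * m / 3) * (\<eta> * n) \<le> (\<delta> / 8 * k) * (\<eta> * n)"
      using k \<delta> n by (intro mult_right_mono mult_left_mono) (auto simp: \<eta>_def)
    also have "\<dots> \<le> of_nat (card V) * (\<eta> * n)"
      using V \<delta> n by (intro mult_right_mono) (auto simp: \<eta>_def)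
    also have "\<dots> \<le> (\<Sum>u\<in>V. real (card (common (a, u))))"
    proof (rule sum_bounded_below)
      fix u assume "u \<in> V"
      then have "(a, u) \<notin> Bad" "u \<in> A0" using U by (auto simp: V_def)
      then show "\<eta> * n \<le> card (common (a, u))" using a by (auto simp: Bad_def)
    qed
    also have "\<dots> = card (Sigma V (\<lambda>u. common (a, u)))"
      using finV fin by (simp add: common_def)
    also have "\<dots> \<le> card ?P"
    proof -
      have "finite ?P" by (rule finite_subset[of _ "A \<times> B"]) (use fin in auto)
      moreover have "Sigma V (\<lambda>u. common (a, u)) \<subseteq> ?P"
        using U A0 by (auto simp: V_def common_def)
      ultimately show ?thesis by (simp add: card_mono)
    qed
    finally have "\<delta> ^ 5 / 3072 * (m * n) \<le> card ?P"
      by (simp add: \<eta>_def eval_nat_numeral algebra_simps)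
    \<comment> \<open>The losses multiply to 8 * 3 * 128 = 3072, rounded up to a power of
      two.\<close>
    moreover have "\<delta> ^ 5 / 2 ^ 12 * (m * n) \<le> \<delta> ^ 5 / 3072 * (m * n)"
      using \<delta> m n by (intro mult_right_mono) (auto simp: field_simps)
    ultimately show ?thesis by (simp add: m_def n_def mult.assoc)
  qed
  moreover have "A' \<subseteq> A" using U A0 by (auto simp: A'_def)
  moreover have "B' \<subseteq> B" by (auto simp: B'_def)
  moreover have "\<delta> / 6 * card A \<le> card A'" using k A' by (simp add: m_def)
  ultimately show ?thesis using B' that by (simp add: n_def)
qed

text \<open>The weight of \<open>z\<close> is the size of its own fibre. Since the mean weight is at
  least \<open>2 * t\<close>, cutting at \<open>t\<close> loses at most half of the sum.\<close>

lemma card_popular_fibers_ge: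
  fixes t M :: real
  assumes "finite Z" "t \<ge> 0" and "\<And>z. z \<in> Z \<Longrightarrow> card {z'\<in>Z. f z' = f z} \<le> M"
    and "2 * t * card Z \<le> (\<Sum>z\<in>Z. real (card {z'\<in>Z. f z' = f z}))"
  shows "t * card Z \<le> M * card {z\<in>Z. t \<le> card {z'\<in>Z. f z' = f z}}"
  using card_popular_ge[of Z "\<lambda>z. real (card {z'\<in>Z. f z' = f z})" M t] assms by simp

section \<open>Ruzsa calculus for product sets\<close>

context group
begin

lemma card_fiber_mult_le:
  assumes "A \<subseteq> carrier G" "B \<subseteq> carrier G" "finite A" "finite B"
  shows "card {z \<in> A \<times> B. fst z \<otimes> snd z = g} \<le> card A"
    and "card {z \<in> A \<times> B. fst z \<otimes> snd z = g} \<le> card B"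
proof -
  have "inj_on fst {z \<in> A \<times> B. fst z \<otimes> snd z = g}"
    "inj_on snd {z \<in> A \<times> B. fst z \<otimes> snd z = g}"
    using assms(1,2) by (auto intro!: inj_onI simp: subset_iff)
  then show "card {z \<in> A \<times> B. fst z \<otimes> snd z = g} \<le> card A"
    "card {z \<in> A \<times> B. fst z \<otimes> snd z = g} \<le> card B"
    using assms(3,4) by (force intro: card_inj_on_le[where f = fst] card_inj_on_le[where f = snd])+
qed

lemma set_mult_image: "A <#> B = (\<lambda>z. fst z \<otimes> snd z) ` (A \<times> B)"
  by (force simp: set_mult_def)

lemma set_inv_image: "set_inv A = (\<lambda>x. inv x) ` A"
  by (auto simp: SET_INV_def)

lemma finite_set_mult: "finite A \<Longrightarrow> finite B \<Longrightarrow> finite (A <#> B)"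
  by (simp add: set_mult_image)

text \<open>The quotient of \<open>x\<close> by \<open>y\<close> is also the quotient of
  \<open>x \<otimes> b\<close> by \<open>y \<otimes> b\<close>. Letting \<open>b\<close> vary gives
  each element of \<open>P <#> set_inv P\<close> at least \<open>card B\<close> preimages in the
  square of \<open>P <#> B\<close>.\<close>

lemma ruzsa_triangle:
  assumes P: "P \<subseteq> carrier G" "finite P" and B: "B \<subseteq> carrier G" "finite B"
  shows "card B * card (P <#> set_inv P) \<le> card (P <#> B) ^ 2"
proof -
  let ?W = "P <#> B" and ?f = "\<lambda>z. fst z \<otimes> inv (snd z)"
  have "real (card B) * card (P <#> set_inv P) \<le> card (?W \<times> ?W)"
  proof (rule card_le_by_fibers[where f = ?f])
    show "finite (?W \<times> ?W)" "finite (P <#> set_inv P)"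
      using P B by (simp_all add: finite_set_mult set_inv_image)
    fix t assume "t \<in> P <#> set_inv P"
    then obtain x y where xy: "x \<in> P" "y \<in> P" "t = x \<otimes> inv y"
      by (auto simp: set_mult_def SET_INV_def)
    have [simp]: "x \<in> carrier G" "y \<in> carrier G" using xy P by auto
    have "card B \<le> card {z \<in> ?W \<times> ?W. ?f z = t}"
    proof (rule card_inj_on_le[where f = "\<lambda>b. (x \<otimes> b, y \<otimes> b)"])
      show "inj_on (\<lambda>b. (x \<otimes> b, y \<otimes> b)) B"
        using B by (auto intro!: inj_onI simp: subset_iff)
      have "x \<otimes> b \<otimes> inv (y \<otimes> b) = t" if "b \<in> B" for b
      proof -
        have "b \<in> carrier G" using that B by auto
        then show ?thesis
          using xy by (simp add: inv_mult_group m_assoc inv_solve_right' flip: m_assoc[of b "inv b"])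
      qed
      then show "(\<lambda>b. (x \<otimes> b, y \<otimes> b)) ` B \<subseteq> {z \<in> ?W \<times> ?W. ?f z = t}"
        using xy by (auto simp: set_mult_def)
    qed (use P B in \<open>simp add: finite_set_mult\<close>)
    then show "real (card B) \<le> card {z \<in> ?W \<times> ?W. ?f z = t}" by simp
  qed
  then have "real (card B * card (P <#> set_inv P)) \<le> real (card ?W ^ 2)"
    by (simp add: power2_eq_square card_cartesian_product)
  then show ?thesis by linarith
qed

text \<open>Some \<open>x\<close> is a product \<open>p \<otimes> s\<close> at least as often as the
  average. Each such \<open>p\<close> equals \<open>x \<otimes> inv s\<close>, which lies in
  \<open>x <# S\<close> by symmetry.\<close>

lemma large_left_translate:
  assumes P: "P \<subseteq> carrier G" "finite P" "P \<noteq> {}" and S: "S \<subseteq> carrier G" "finite S" "S \<noteq> {}"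
    and sym: "set_inv S = S"
  obtains x where "x \<in> carrier G" "real (card P) * card S \<le> real (card (P <#> S)) * card (P \<inter> (x <# S))"
proof -
  let ?f = "\<lambda>z. fst z \<otimes> snd z"
  obtain x where x: "x \<in> P <#> S"
    and le: "card (P \<times> S) \<le> real (card (P <#> S)) * card {z \<in> P \<times> S. ?f z = x}"
    by (rule large_fiber[of "P \<times> S" "P <#> S" ?f])
      (use P S in \<open>auto simp: finite_set_mult set_mult_image\<close>)
  have "card {z \<in> P \<times> S. ?f z = x} \<le> card (P \<inter> (x <# S))"
  proof (rule card_inj_on_le[where f = fst])
    show "inj_on fst {z \<in> P \<times> S. ?f z = x}"
      using P(1) S(1) by (auto intro!: inj_onI simp: subset_iff)
    have "p \<in> x <# S" if "p \<in> P" "s \<in> S" "p \<otimes> s = x" for p s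
    proof -
      have "p \<in> carrier G" "s \<in> carrier G" using that P S by auto
      then have "p = x \<otimes> inv s" using that by (auto simp: m_assoc)
      moreover have "inv s \<in> S" using that sym by (auto simp: SET_INV_def)
      ultimately show ?thesis by (auto simp: l_coset_def)
    qed
    then show "fst ` {z \<in> P \<times> S. ?f z = x} \<subseteq> P \<inter> (x <# S)" by auto
  qed (use P in simp)
  then have "real (card (P <#> S)) * card {z \<in> P \<times> S. ?f z = x} \<le> real (card (P <#> S)) * card (P \<inter> (x <# S))"
    by (intro mult_left_mono) auto
  moreover have "x \<in> carrier G" using x P S by (auto simp: set_mult_def)
  ultimately show ?thesis using le that by (simp add: card_cartesian_product)
qed

lemma large_right_translate:
  assumes P: "P \<subseteq> carrier G" "finite P" "P \<noteq> {}" and S: "S \<subseteq> carrier G" "finite S" "S \<noteq> {}"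
    and sym: "set_inv S = S"
  obtains y where "y \<in> carrier G" "real (card P) * card S \<le> real (card (S <#> P)) * card (P \<inter> (S #> y))"
proof -
  let ?f = "\<lambda>z. fst z \<otimes> snd z"
  obtain y where y: "y \<in> S <#> P"
    and le: "card (S \<times> P) \<le> real (card (S <#> P)) * card {z \<in> S \<times> P. ?f z = y}"
    by (rule large_fiber[of "S \<times> P" "S <#> P" ?f])
      (use P S in \<open>auto simp: finite_set_mult set_mult_image\<close>)
  have "card {z \<in> S \<times> P. ?f z = y} \<le> card (P \<inter> (S #> y))"
  proof (rule card_inj_on_le[where f = snd])
    show "inj_on snd {z \<in> S \<times> P. ?f z = y}"
      using P(1) S(1) by (auto intro!: inj_onI simp: subset_iff)
    have "p \<in> S #> y" if "p \<in> P" "s \<in> S" "s \<otimes> p = y" for p s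
    proof -
      have "p \<in> carrier G" "s \<in> carrier G" using that P S by auto
      then have "p = inv s \<otimes> y" using that by (auto simp flip: m_assoc)
      moreover have "inv s \<in> S" using that sym by (auto simp: SET_INV_def)
      ultimately show ?thesis by (auto simp: r_coset_def)
    qed
    then show "snd ` {z \<in> S \<times> P. ?f z = y} \<subseteq> P \<inter> (S #> y)" by auto
  qed (use P in simp)
  then have "real (card (S <#> P)) * card {z \<in> S \<times> P. ?f z = y} \<le> real (card (S <#> P)) * card (P \<inter> (S #> y))"
    by (intro mult_left_mono) auto
  moreover have "y \<in> carrier G" using y P S by (auto simp: set_mult_def)
  ultimately show ?thesis using le that by (simp add: card_cartesian_product mult.commute)
qed

text \<open>Ruzsa covering: choose a maximal subset of \<open>T\<close> whose left translates of
  \<open>S\<close> are disjoint. Disjointness bounds its size; by maximality every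
  \<open>t <# S\<close> meets some \<open>x <# S\<close>, which puts \<open>t\<close> into
  \<open>x <# (S <#> S)\<close>.\<close>

lemma symmetric_covering:
  assumes S: "S \<subseteq> carrier G" "finite S" "S \<noteq> {}" "set_inv S = S"
    and T: "T \<subseteq> carrier G" "finite T" "set_inv T = T"
  obtains X where "X \<subseteq> T" "set_inv X = X" "card X * card S \<le> 2 * card (T <#> S)"
    "T \<subseteq> X <#> (S <#> S)"
proof -
  define ok where "ok X \<longleftrightarrow> X \<subseteq> T \<and> disjoint_family_on (\<lambda>x. x <# S) X" for X
  have "ok {}" by (simp add: ok_def disjoint_family_on_def)
  moreover have "finite {X. ok X}"
    by (rule finite_subset[of _ "Pow T"]) (use T in \<open>auto simp: ok_def\<close>)
  ultimately obtain X where X: "ok X" and max: "\<And>Y. ok Y \<Longrightarrow> X \<subseteq> Y \<Longrightarrow> Y = X"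
    using finite_has_maximal[of "{X. ok X}"] by blast
  have XT: "X \<subseteq> T" and finX: "finite X" using X T finite_subset by (auto simp: ok_def)
  have "card (x <# S) = card S" if "x \<in> X" for x
  proof -
    have "x \<in> carrier G" using that XT T by auto
    then have "inj_on (\<lambda>s. x \<otimes> s) S" using S(1) by (auto intro!: inj_onI simp: subset_iff)
    moreover have "x <# S = (\<lambda>s. x \<otimes> s) ` S" by (auto simp: l_coset_def)
    ultimately show ?thesis by (simp add: card_image)
  qed
  then have "card X * card S = (\<Sum>x\<in>X. card (x <# S))" by simp
  also have "\<dots> = card (\<Union>x\<in>X. x <# S)"
    using X finX S by (subst card_UN_disjoint') (auto simp: ok_def l_coset_def)
  also have "\<dots> \<le> card (T <#> S)"
    using XT T S by (intro card_mono) (auto simp: finite_set_mult l_coset_def set_mult_def)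
  finally have card: "card X * card S \<le> card (T <#> S)" .
  have cover: "T \<subseteq> X <#> (S <#> S)"
  proof
    fix t assume t: "t \<in> T"
    obtain x where x: "x \<in> X" "(x <# S) \<inter> (t <# S) \<noteq> {}"
    proof (cases "t \<in> X")
      case True
      then show ?thesis using that[of t] S by (auto simp: l_coset_def)
    next
      case False
      then have "\<not> ok (insert t X)" using max[of "insert t X"] by auto
      then have "\<exists>x\<in>X. (x <# S) \<inter> (t <# S) \<noteq> {}"
        using X t False by (auto simp: ok_def disjoint_family_on_def)
      then show ?thesis using that by blast
    qed
    then obtain s s' where s: "s \<in> S" "s' \<in> S" "x \<otimes> s = t \<otimes> s'" by (auto simp: l_coset_def)
    have c: "s \<in> carrier G" "s' \<in> carrier G" "t \<in> carrier G" "x \<in> carrier G"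
      using s t x XT S T by auto
    then have "t = x \<otimes> s \<otimes> inv s'" using s by (simp add: m_assoc)
    then have "t = x \<otimes> (s \<otimes> inv s')" using c by (simp add: m_assoc)
    moreover have "inv s' \<in> S" using s S(4) by (auto simp: SET_INV_def)
    ultimately show "t \<in> X <#> (S <#> S)" using s x by (auto simp: set_mult_def)
  qed
  \<comment> \<open>The maximal family need not be symmetric. Adding inverses stays inside the
    symmetric set \<open>T\<close> and costs the factor 2.\<close>
  let ?Y = "X \<union> set_inv X"
  have "set_inv (set_inv X) = X" using XT T by (force simp: set_inv_image)
  then have "set_inv ?Y = ?Y" by (auto simp: set_inv_image image_Un)
  moreover have "?Y \<subseteq> T" using XT T(3) by (auto simp: SET_INV_def)
  moreover have "card ?Y * card S \<le> 2 * card (T <#> S)"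
  proof -
    have "card ?Y \<le> card X + card X"
      using finX by (intro order.trans[OF card_Un_le] add_mono) (auto simp: set_inv_image card_image_le)
    then have "card ?Y * card S \<le> (card X + card X) * card S" by (rule mult_right_mono) simp
    then show ?thesis using card by (simp add: algebra_simps)
  qed
  moreover have "T \<subseteq> ?Y <#> (S <#> S)" using cover by (auto simp: set_mult_def)
  ultimately show ?thesis using that by blast
qed

section \<open>Popular quotients of a set with small quotient set\<close>

text \<open>The hypothesis concerns quotients \<open>x \<otimes> inv y\<close>, while
  \<open>S\<close> collects popular quotients \<open>inv x \<otimes> y\<close>. Both kinds have the
  same number of coincidences, so Cauchy--Schwarz for the first kind provides many popular values of
  the second.\<close>

lemma popular_quotients:
  fixes K :: real
  assumes P: "P \<subseteq> carrier G" "finite P" "P \<noteq> {}" and K: "card (P <#> set_inv P) \<le> K * card P"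
  obtains S where "S \<subseteq> carrier G" "finite S" "\<one> \<in> S" "set_inv S = S" "card P \<le> 2 * K * card S"
    "\<And>Y. Y \<subseteq> carrier G \<Longrightarrow> finite Y \<Longrightarrow> card (P <#> (S <#> Y)) \<le> 2 * K\<^sup>2 * card (P <#> Y)"
proof -
  define p where "p = real (card P)"
  have p: "p > 0" using P by (simp add: p_def card_gt_0_iff)
  let ?Q = "P <#> set_inv P"
  have Q: "finite ?Q" using P by (simp add: finite_set_mult set_inv_image)
  \<comment> \<open>A right translate of \<open>P\<close> lies in \<open>?Q\<close>. This forces
    \<open>K \<ge> 1\<close>, so that the identity, represented \<open>p\<close> times, passes the
    threshold \<open>t\<close>.\<close>
  have "p \<le> card ?Q"
  proof -
    obtain q where q: "q \<in> P" using P by auto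
    then have "inj_on (\<lambda>x. x \<otimes> inv q) P" "(\<lambda>x. x \<otimes> inv q) ` P \<subseteq> ?Q"
      using P by (auto intro!: inj_onI simp: set_mult_def SET_INV_def subset_iff)
    then show ?thesis using Q by (simp add: p_def card_inj_on_le)
  qed
  then have "p \<le> K * p" using K by (simp add: p_def)
  then have K1: "K \<ge> 1" using p by simp
  define f where "f z = inv (fst z) \<otimes> snd z" for z
  define R where "R g = {z \<in> P \<times> P. f z = g}" for g
  \<comment> \<open>Half of \<open>p / K\<close>, a lower bound for the mean fibre size of
    \<open>f\<close> over \<open>P \<times> P\<close>.\<close>
  define t where "t = p / (2 * K)"
  have t: "t > 0" using p K1 by (simp add: t_def)
  define S where "S = {g. t \<le> card (R g)}"
  have finR: "finite (R g)" for g using P by (simp add: R_def)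
  have Rne: "R g \<noteq> {}" if "g \<in> S" for g using that t by (auto simp: S_def)
  have "S \<subseteq> f ` (P \<times> P)" using Rne by (force simp: R_def)
  moreover have "f ` (P \<times> P) \<subseteq> carrier G" using P by (auto simp: f_def subset_iff)
  ultimately have S: "S \<subseteq> carrier G" "finite S" using P by (auto intro: finite_subset)
  have "inj_on (\<lambda>x. (x, x)) P" "(\<lambda>x. (x, x)) ` P \<subseteq> R \<one>"
    using P by (auto simp: R_def f_def intro!: inj_onI)
  then have "p \<le> card (R \<one>)" using finR by (simp add: p_def card_inj_on_le)
  moreover have "t \<le> p" using p K1 by (simp add: t_def field_simps)
  ultimately have one: "\<one> \<in> S" by (simp add: S_def)
  have inv_S: "inv g \<in> S" if "g \<in> S" for g
  proof -
    have "card (R g) \<le> card (R (inv g))"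
    proof (rule card_inj_on_le[where f = prod.swap])
      have "inv (inv x \<otimes> y) = inv y \<otimes> x" if "x \<in> P" "y \<in> P" for x y
        using that P by (simp add: inv_mult_group subset_iff)
      then show "prod.swap ` R g \<subseteq> R (inv g)" by (auto simp: R_def f_def)
    qed (use finR in auto)
    then show ?thesis using that by (auto simp: S_def)
  qed
  have sym: "set_inv S = S"
  proof
    show "set_inv S \<subseteq> S" using inv_S by (auto simp: SET_INV_def)
    show "S \<subseteq> set_inv S"
    proof
      fix g assume "g \<in> S"
      then have "inv g \<in> S" "g = inv (inv g)" using inv_S S by auto
      then show "g \<in> set_inv S" unfolding SET_INV_def by blast
    qed
  qed

  have cardS: "card P \<le> 2 * K * card S"
  proof -
    have fib: "card {z' \<in> P \<times> P. f z' = f z} \<le> p" if "z \<in> P \<times> P" for z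
    proof -
      have "inj_on fst {z' \<in> P \<times> P. f z' = f z}"
      proof (rule inj_onI)
        fix u v assume "u \<in> {z' \<in> P \<times> P. f z' = f z}" "v \<in> {z' \<in> P \<times> P. f z' = f z}" "fst u = fst v"
        then have "inv (fst u) \<otimes> snd u = inv (fst u) \<otimes> snd v" "fst u \<in> carrier G" "snd u \<in> carrier G" "snd v \<in> carrier G"
          using P(1) by (auto simp: f_def)
        then show "u = v" using \<open>fst u = fst v\<close> by (simp add: prod_eq_iff)
      qed
      then have "card {z' \<in> P \<times> P. f z' = f z} \<le> card P"
        by (rule card_inj_on_le) (use P in auto)
      then show ?thesis by (simp add: p_def)
    qed
    let ?h = "\<lambda>z. fst z \<otimes> inv (snd z)"
    \<comment> \<open>\<open>x\<inverse> y = x'\<inverse> y'\<close> iff \<open>x' x\<inverse> = y' y\<inverse>\<close>\<close>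
    have "(\<Sum>z\<in>P \<times> P. card {z' \<in> P \<times> P. ?h z' = ?h z}) \<le> (\<Sum>z\<in>P \<times> P. card {z' \<in> P \<times> P. f z' = f z})"
      (is "sum ?ch _ \<le> sum ?cf _")
    proof -
      let ?H = "Sigma (P \<times> P) (\<lambda>z. {z' \<in> P \<times> P. ?h z' = ?h z})"
      let ?F = "Sigma (P \<times> P) (\<lambda>z. {z' \<in> P \<times> P. f z' = f z})"
      let ?swap = "\<lambda>((y', y), (x', x)). ((x, y), (x', y'))"
      have "inv x' \<otimes> y' = inv x \<otimes> y"
        if "x' \<otimes> inv x = y' \<otimes> inv y" "x \<in> P" "y \<in> P" "x' \<in> P" "y' \<in> P" for x y x' y'
      proof -
        have c: "x \<in> carrier G" "y \<in> carrier G" "x' \<in> carrier G" "y' \<in> carrier G"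
          using that P by auto
        have "inv x' \<otimes> y' = inv x' \<otimes> (y' \<otimes> inv y) \<otimes> y" using c by (simp add: m_assoc)
        also have "\<dots> = inv x' \<otimes> (x' \<otimes> inv x) \<otimes> y" by (simp add: that(1))
        also have "\<dots> = inv x \<otimes> y" using c by (simp flip: m_assoc)
        finally show ?thesis .
      qed
      then have img: "?swap ` ?H \<subseteq> ?F" by (auto simp: f_def)
      have "inj_on ?swap ?H" by (auto intro!: inj_onI)
      then have "card ?H \<le> card ?F"
        by (rule card_inj_on_le[OF _ img]) (use P in auto)
      then show ?thesis using P by simp
    qed
    then have "real (sum ?ch (P \<times> P)) \<le> real (sum ?cf (P \<times> P))" by linarith
    then have "card ?Q * (\<Sum>z\<in>P \<times> P. real (?ch z)) \<le> K * p * (\<Sum>z\<in>P \<times> P. real (?cf z))"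
      using K by (intro mult_mono) (auto simp: p_def intro!: sum_nonneg)
    moreover have "(p * p)\<^sup>2 \<le> card ?Q * (\<Sum>z\<in>P \<times> P. real (card {z' \<in> P \<times> P. ?h z' = ?h z}))"
    proof -
      have "?h ` (P \<times> P) \<subseteq> ?Q" unfolding set_mult_def SET_INV_def by fastforce
      then show ?thesis
        using sum_fibers_squared[of "P \<times> P" ?Q ?h] P(2) Q by (simp add: p_def card_cartesian_product)
    qed
    ultimately have "(p * p)\<^sup>2 \<le> K * p * (\<Sum>z\<in>P \<times> P. real (card {z' \<in> P \<times> P. f z' = f z}))"
      by linarith
    then have "2 * t * card (P \<times> P) \<le> (\<Sum>z\<in>P \<times> P. real (card {z' \<in> P \<times> P. f z' = f z}))"
      using p K1 by (simp add: t_def card_cartesian_product power2_eq_square field_simps flip: p_def)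
    from card_popular_fibers_ge[OF _ _ fib this]
    have "t * (p * p) \<le> p * card {z \<in> P \<times> P. t \<le> card (R (f z))}"
      using P t by (simp add: R_def p_def card_cartesian_product)
    also have "card {z \<in> P \<times> P. t \<le> card (R (f z))} \<le> p * card S"
    proof -
      \<comment> \<open>Popular pairs lie in fibres over \<open>S\<close>, each of size at most
        \<open>p\<close>.\<close>
      have "{z \<in> P \<times> P. t \<le> card (R (f z))} \<subseteq> (\<Union>g\<in>S. R g)"
        by (auto simp: S_def R_def)
      then have "card {z \<in> P \<times> P. t \<le> card (R (f z))} \<le> card (\<Union>g\<in>S. R g)"
        using S finR by (intro card_mono) auto
      also have "\<dots> \<le> (\<Sum>g\<in>S. card (R g))" using S(2) by (rule card_UN_le)
      finally have "real (card {z \<in> P \<times> P. t \<le> card (R (f z))}) \<le> (\<Sum>g\<in>S. real (card (R g)))"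
        by (simp flip: of_nat_sum)
      also have "\<dots> \<le> of_nat (card S) * p"
      proof (rule sum_bounded_above)
        fix g assume "g \<in> S"
        then obtain z where "z \<in> R g" using Rne by blast
        then show "card (R g) \<le> p" using fib[of z] by (auto simp: R_def)
      qed
      finally show ?thesis by (simp add: mult.commute)
    qed
    finally have "p * (p * t) \<le> p * (p * card S)" using p by (simp add: algebra_simps)
    then have "t \<le> card S" using p by simp
    then show ?thesis using K1 by (simp add: t_def p_def field_simps)
  qed

  have step: "card (P <#> (S <#> Y)) \<le> 2 * K\<^sup>2 * card (P <#> Y)"
    if Y: "Y \<subseteq> carrier G" "finite Y" for Y
  proof -
    let ?W = "?Q \<times> (P <#> Y)" and ?m = "\<lambda>z. fst z \<otimes> snd z"
    have "t * card (P <#> (S <#> Y)) \<le> card ?W"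
    proof (rule card_le_by_fibers[where f = ?m])
      fix g assume "g \<in> P <#> (S <#> Y)"
      then obtain x s y where g: "x \<in> P" "s \<in> S" "y \<in> Y" "g = x \<otimes> (s \<otimes> y)"
        by (auto simp: set_mult_def)
      have c: "x \<in> carrier G" "s \<in> carrier G" "y \<in> carrier G" using g P S Y by auto
      \<comment> \<open>Each of the at least \<open>t\<close> representations
        \<open>s = inv u \<otimes> v\<close> splits \<open>g\<close> as
        \<open>(x \<otimes> inv u) \<otimes> (v \<otimes> y)\<close>. Dividing \<open>K * p\<close>
        by \<open>t\<close> produces the factor \<open>2 * K\<^sup>2\<close>.\<close>
      let ?F = "\<lambda>z. (x \<otimes> inv (fst z), snd z \<otimes> y)"
      have "card (R s) \<le> card {z \<in> ?W. ?m z = g}"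
      proof (rule card_inj_on_le[where f = ?F])
        show "inj_on ?F (R s)"
          using P c by (intro inj_onI) (auto simp: R_def subset_iff prod_eq_iff dest!: inj_onD[OF inv_inj])
        show "?F ` R s \<subseteq> {z \<in> ?W. ?m z = g}"
        proof (rule image_subsetI)
          fix z assume "z \<in> R s"
          then obtain u v where z: "z = (u, v)" "u \<in> P" "v \<in> P" "s = inv u \<otimes> v"
            by (auto simp: R_def f_def)
          have uv: "u \<in> carrier G" "v \<in> carrier G" using z P by auto
          have "x \<otimes> inv u \<in> ?Q" "v \<otimes> y \<in> P <#> Y"
            unfolding set_mult_def SET_INV_def using g z by blast+
          moreover have "x \<otimes> inv u \<otimes> (v \<otimes> y) = g" using c uv by (simp add: g z m_assoc)
          ultimately show "?F z \<in> {z \<in> ?W. ?m z = g}" by (simp add: z)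
        qed
      qed (use P Y Q in \<open>simp add: finite_set_mult\<close>)
      then show "t \<le> card {z \<in> ?W. ?m z = g}" using g by (simp add: S_def)
    qed (use P Y Q S in \<open>simp_all add: finite_set_mult\<close>)
    also have "\<dots> \<le> K * p * card (P <#> Y)"
      using K by (simp add: card_cartesian_product p_def mult_right_mono)
    finally show ?thesis using p K1 by (simp add: t_def power2_eq_square field_simps)
  qed
  show ?thesis using that[OF S one sym cardS step] .
qed


section \<open>Multiplicative energy and popular products\<close>

text \<open>A quadruple counted by the energy is a pair of points of \<open>A \<times> B\<close> in
  one fibre of multiplication. This form fits the popularity lemmas.\<close>

lemma mult_energy_le_sum_fibers:
  assumes "finite A" "finite B"
  shows "mult_energy G A B
    \<le> (\<Sum>z\<in>A \<times> B. card {z' \<in> A \<times> B. fst z' \<otimes> snd z' = fst z \<otimes> snd z})"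
proof -
  let ?F = "Sigma (A \<times> B) (\<lambda>z. {z' \<in> A \<times> B. fst z' \<otimes> snd z' = fst z \<otimes> snd z})"
  have "mult_energy G A B \<le> card ?F"
    unfolding mult_energy_def
    by (rule card_inj_on_le[where f = "\<lambda>(a1, a2, b1, b2). ((a1, b1), (a2, b2))"])
      (use assms in \<open>auto intro!: inj_onI\<close>)
  then show ?thesis using assms by simp
qed

lemma mult_energy_le:
  assumes "A \<subseteq> carrier G" "B \<subseteq> carrier G" "finite A" "finite B"
  shows "mult_energy G A B \<le> card A * card B * card A"
    and "mult_energy G A B \<le> card A * card B * card B"
proof -
  have "(\<Sum>z\<in>A \<times> B. card {z' \<in> A \<times> B. fst z' \<otimes> snd z' = fst z \<otimes> snd z}) \<le> of_nat (card (A \<times> B)) * card A"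
    "(\<Sum>z\<in>A \<times> B. card {z' \<in> A \<times> B. fst z' \<otimes> snd z' = fst z \<otimes> snd z}) \<le> of_nat (card (A \<times> B)) * card B"
    by (rule sum_bounded_above; rule card_fiber_mult_le; use assms in auto)+
  then show "mult_energy G A B \<le> card A * card B * card A"
    and "mult_energy G A B \<le> card A * card B * card B"
    using mult_energy_le_sum_fibers[OF assms(3,4)] by (simp_all add: card_cartesian_product)
qed

text \<open>Here \<open>s\<close> is the geometric mean of the two sizes, so the denominator of the
  normalized energy is \<open>s ^ 3\<close>. Comparing with the trivial bounds on the energy shows
  that high energy forces \<open>A\<close> and \<open>B\<close> to have comparable sizes.\<close>

lemma normalized_energy_ge_imp:
  fixes \<alpha> :: real
  assumes "A \<subseteq> carrier G" "B \<subseteq> carrier G" "finite A" "finite B" "A \<noteq> {}" "B \<noteq> {}"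
    and \<alpha>: "\<alpha> \<ge> 1" and e: "normalized_energy G A B \<ge> inverse \<alpha>"
  defines "s \<equiv> sqrt (real (card A) * real (card B))"
  shows "s ^ 3 \<le> \<alpha> * mult_energy G A B" "s \<le> \<alpha> * card A" "s \<le> \<alpha> * card B"
    "card A \<le> \<alpha>\<^sup>2 * card B"
proof -
  define m n where "m = real (card A)" and "n = real (card B)"
  have m: "m > 0" and n: "n > 0"
    using assms by (simp_all add: m_def n_def card_gt_0_iff)
  have s: "s > 0" "s\<^sup>2 = m * n" using m n by (simp_all add: s_def m_def n_def)
  have "(m * n) powr (3 / 2) = (m * n) powr (1 + 1 / 2)" by simp
  also have "\<dots> = s ^ 3"
    using m n s(2) by (subst powr_add) (simp add: powr_half_sqrt s_def m_def n_def power3_eq_cube power2_eq_square)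
  finally have "inverse \<alpha> \<le> mult_energy G A B / s ^ 3"
    using e by (simp add: normalized_energy_def m_def n_def)
  then show E: "s ^ 3 \<le> \<alpha> * mult_energy G A B"
    using \<alpha> s by (simp add: field_simps)
  have le: "s \<le> \<alpha> * x" if "mult_energy G A B \<le> m * n * x" for x
  proof -
    have "s\<^sup>2 * s \<le> \<alpha> * mult_energy G A B" using E by (simp add: power2_eq_square power3_eq_cube)
    also have "\<dots> \<le> \<alpha> * (s\<^sup>2 * x)" using that \<alpha> s by (intro mult_left_mono) auto
    finally have "s\<^sup>2 * s \<le> s\<^sup>2 * (\<alpha> * x)" by (simp only: mult.left_commute)
    then show ?thesis by (rule mult_left_le_imp_le) (use s(1) in simp)
  qed
  have "real (mult_energy G A B) \<le> real (card A * card B * card A)"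
    "real (mult_energy G A B) \<le> real (card A * card B * card B)"
    using mult_energy_le[OF assms(1-4)] by (simp_all only: of_nat_le_iff)
  then show sA: "s \<le> \<alpha> * card A" and sB: "s \<le> \<alpha> * card B"
    by (auto intro!: le simp: m_def n_def)
  have "m * n \<le> (\<alpha> * n)\<^sup>2" using sB s by (metis n_def less_imp_le power_mono)
  then have "n * m \<le> n * (\<alpha>\<^sup>2 * n)" by (simp add: power2_eq_square algebra_simps)
  then show "card A \<le> \<alpha>\<^sup>2 * card B" using n by (simp add: m_def n_def)
qed

text \<open>The graph lemma is applied to the pairs with popular product, of density at least
  \<open>1 / (2 * \<alpha>)\<close>. The set \<open>D\<close> of popular products has at most
  \<open>2 * \<alpha> * s\<close> elements, and many paths mean many representations by triples from
  \<open>D\<close>.\<close>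

lemma balog_szemeredi_gowers:
  fixes \<alpha> :: real
  assumes A: "A \<subseteq> carrier G" "finite A" "A \<noteq> {}" and B: "B \<subseteq> carrier G" "finite B" "B \<noteq> {}"
    and \<alpha>: "\<alpha> \<ge> 1" and e: "normalized_energy G A B \<ge> inverse \<alpha>"
  obtains A' B' where "A' \<subseteq> A" "B' \<subseteq> B" "card A \<le> 12 * \<alpha> * card A'" "card B \<le> 8 * \<alpha> * card B'"
    "card (A' <#> B') \<le> 2 ^ 20 * \<alpha> ^ 8 * sqrt (real (card A) * real (card B))"
proof -
  define s where "s = sqrt (real (card A) * real (card B))"
  have s: "s > 0" "s\<^sup>2 = real (card A) * real (card B)" using A B by (simp_all add: s_def card_gt_0_iff)
  define f where "f z = fst z \<otimes> snd z" for z
  define R where "R g = {z \<in> A \<times> B. f z = g}" for g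
  \<comment> \<open>The energy is at least \<open>s ^ 3 / \<alpha>\<close>, so the mean fibre size
    over the \<open>s\<^sup>2\<close> pairs is at least \<open>2 * t\<close>.\<close>
  define t where "t = s / (2 * \<alpha>)"
  have t: "t > 0" using s \<alpha> by (simp add: t_def)
  define E where "E = {z \<in> A \<times> B. t \<le> card (R (f z))}"
  define D where "D = {g. t \<le> card (R g)}"
  have finR: "finite (R g)" for g using A B by (simp add: R_def)
  have Rne: "R g \<noteq> {}" if "g \<in> D" for g using that t by (auto simp: D_def)
  have D: "finite D"
    by (rule finite_subset[of _ "f ` (A \<times> B)"]) (use A B Rne in \<open>force simp: R_def\<close>)+
  have cardZ: "real (card (A \<times> B)) = s\<^sup>2" using s by (simp add: card_cartesian_product)

  have "t * card D \<le> card (A \<times> B)"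
    by (rule card_le_by_fibers[where f = f]) (use A B D in \<open>auto simp: D_def R_def\<close>)
  then have cardD: "card D \<le> 2 * \<alpha> * s"
    unfolding cardZ using s \<alpha> by (simp add: t_def power2_eq_square field_simps)

  have "t * card (A \<times> B) \<le> s * card {z \<in> A \<times> B. t \<le> card {z' \<in> A \<times> B. f z' = f z}}"
  proof (rule card_popular_fibers_ge)
    fix z assume z: "z \<in> A \<times> B"
    let ?c = "real (card {z' \<in> A \<times> B. f z' = f z})"
    have "?c \<le> card A" "?c \<le> card B"
      using card_fiber_mult_le[OF A(1) B(1) A(2) B(2), of "f z"] by (simp_all add: f_def)
    \<comment> \<open>A fibre is no larger than either set, hence no larger than the geometric
      mean.\<close>
    then show "?c \<le> s"
      unfolding s_def by (intro real_le_rsqrt) (simp add: power2_eq_square mult_mono)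
  next
    have "s ^ 3 \<le> \<alpha> * mult_energy G A B"
      unfolding s_def by (rule normalized_energy_ge_imp) (use assms in auto)
    also have "\<dots> \<le> \<alpha> * real (\<Sum>z\<in>A \<times> B. card {z' \<in> A \<times> B. f z' = f z})"
      unfolding f_def
      by (intro mult_left_mono of_nat_mono mult_energy_le_sum_fibers) (use A B \<alpha> in auto)
    finally show "2 * t * card (A \<times> B) \<le> (\<Sum>z\<in>A \<times> B. real (card {z' \<in> A \<times> B. f z' = f z}))"
      unfolding cardZ using \<alpha> s
      by (simp add: t_def field_simps power2_eq_square power3_eq_cube)
  qed (use A B t in auto)
  then have "s * (t * s) \<le> s * card E" unfolding cardZ by (simp add: E_def R_def power2_eq_square algebra_simps)
  then have "t * s \<le> card E" using s by simp
  moreover have "t * s = 1 / (2 * \<alpha>) * s\<^sup>2" by (simp add: t_def power2_eq_square)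
  ultimately have dense: "1 / (2 * \<alpha>) * card A * card B \<le> card E"
    using s by (simp add: mult.assoc)
  have \<delta>: "1 / (2 * \<alpha>) > 0" using \<alpha> by simp
  have "E \<subseteq> A \<times> B" by (auto simp: E_def)
  then obtain A' B' where A': "A' \<subseteq> A" and B': "B' \<subseteq> B"
    and cards: "1 / (2 * \<alpha>) / 6 * card A \<le> card A'" "1 / (2 * \<alpha>) / 4 * card B \<le> card B'"
    and paths: "\<forall>a\<in>A'. \<forall>b\<in>B'. (1 / (2 * \<alpha>)) ^ 5 / 2 ^ 12 * card A * card B
       \<le> card {(u, v). u \<in> A \<and> v \<in> B \<and> (a, v) \<in> E \<and> (u, v) \<in> E \<and> (u, b) \<in> E}"
    by (rule balog_szemeredi_gowers_graph[OF A(2) B(2) A(3) B(3) _ \<delta> dense])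

  \<comment> \<open>A path \<open>a, v, u, b\<close> writes \<open>a b\<close> as \<open>(a v) (u v)\<inverse> (u b)\<close>, a product of
    three popular elements.\<close>
  have "(1 / (2 * \<alpha>)) ^ 5 / 2 ^ 12 * card A * card B * card (A' <#> B') \<le> card (D \<times> D \<times> D)"
  proof (rule card_le_by_fibers[where f = "\<lambda>(x, y, z). x \<otimes> inv y \<otimes> z"])
    show "finite (A' <#> B')"
      using A A' B B' by (meson finite_set_mult finite_subset)
    fix g assume "g \<in> A' <#> B'"
    then obtain a b where ab: "a \<in> A'" "b \<in> B'" "g = a \<otimes> b" by (auto simp: set_mult_def)
    let ?P = "{(u, v). u \<in> A \<and> v \<in> B \<and> (a, v) \<in> E \<and> (u, v) \<in> E \<and> (u, b) \<in> E}"
    let ?F = "\<lambda>(u, v). (a \<otimes> v, u \<otimes> v, u \<otimes> b)"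
    have c: "a \<in> carrier G" "b \<in> carrier G" using ab A A' B B' by auto
    have "card ?P \<le> card {z \<in> D \<times> D \<times> D. (\<lambda>(x, y, z). x \<otimes> inv y \<otimes> z) z = g}"
    proof (rule card_inj_on_le[where f = ?F])
      show "inj_on ?F ?P"
        using A B c by (intro inj_onI) (auto simp: subset_iff)
      have "a \<otimes> v \<otimes> inv (u \<otimes> v) \<otimes> (u \<otimes> b) = g" if "u \<in> A" "v \<in> B" for u v
      proof -
        have uv: "u \<in> carrier G" "v \<in> carrier G" using that A B by auto
        have "y \<otimes> (inv y \<otimes> z) = z" "inv y \<otimes> (y \<otimes> z) = z" if "y \<in> carrier G" "z \<in> carrier G" for y z
          using that by (simp_all flip: m_assoc)
        then show ?thesis using c uv ab by (simp add: inv_mult_group m_assoc)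
      qed
      moreover have "x \<otimes> y \<in> D" if "(x, y) \<in> E" for x y
        using that by (auto simp: E_def D_def f_def)
      ultimately show "?F ` ?P \<subseteq> {z \<in> D \<times> D \<times> D. (\<lambda>(x, y, z). x \<otimes> inv y \<otimes> z) z = g}"
        by auto
    qed (use D in auto)
    then show "(1 / (2 * \<alpha>)) ^ 5 / 2 ^ 12 * card A * card B
        \<le> card {z \<in> D \<times> D \<times> D. (\<lambda>(x, y, z). x \<otimes> inv y \<otimes> z) z = g}"
      using bspec[OF bspec[OF paths ab(1)] ab(2)] by linarith
  qed (use D in auto)
  also have "real (card (D \<times> D \<times> D)) = real (card D) ^ 3"
    by (simp add: card_cartesian_product power3_eq_cube)
  also have "\<dots> \<le> (2 * \<alpha> * s) ^ 3" using cardD by (intro power_mono) auto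
  also have "\<dots> = s\<^sup>2 * (8 * \<alpha> ^ 3 * s)"
    by (simp add: power2_eq_square power3_eq_cube)
  also have "(1 / (2 * \<alpha>)) ^ 5 / 2 ^ 12 * card A * card B * card (A' <#> B')
      = s\<^sup>2 * ((1 / (2 * \<alpha>)) ^ 5 / 2 ^ 12 * card (A' <#> B'))"
    unfolding s(2) by (simp only: mult_ac)
  finally have "s\<^sup>2 * ((1 / (2 * \<alpha>)) ^ 5 / 2 ^ 12 * card (A' <#> B')) \<le> s\<^sup>2 * (8 * \<alpha> ^ 3 * s)" .
  then have "(1 / (2 * \<alpha>)) ^ 5 / 2 ^ 12 * card (A' <#> B') \<le> 8 * \<alpha> ^ 3 * s"
    by (rule mult_left_le_imp_le) (use s(1) in simp)
  \<comment> \<open>The exponents add up as 3 + 12 + 5 = 20 for 2 and 3 + 5 = 8 for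
    \<open>\<alpha>\<close>.\<close>
  then have "card (A' <#> B') \<le> (8 * \<alpha> ^ 3 * s) * (2 ^ 12 * (2 * \<alpha>) ^ 5)"
    using \<alpha> by (simp add: field_simps)
  also have "\<dots> = 2 ^ 20 * \<alpha> ^ 8 * s"
    by (simp add: power_mult_distrib flip: power_add)
  finally have "card (A' <#> B') \<le> 2 ^ 20 * \<alpha> ^ 8 * s" .
  moreover have "card A \<le> 12 * \<alpha> * card A'" "card B \<le> 8 * \<alpha> * card B'"
    using cards \<alpha> by (simp_all add: field_simps)
  ultimately show ?thesis using that A' B' by (simp add: s_def)
qed

section \<open>Iterated product sets\<close>

lemma card_le_card_set_mult:
  assumes "P \<subseteq> carrier G" "P \<noteq> {}" "finite P" "Y \<subseteq> carrier G" "finite Y"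
  shows "card Y \<le> card (P <#> Y)"
proof -
  obtain x where "x \<in> P" using assms by auto
  then have "inj_on (\<lambda>y. x \<otimes> y) Y" "(\<lambda>y. x \<otimes> y) ` Y \<subseteq> P <#> Y"
    using assms by (auto intro!: inj_onI simp: set_mult_def subset_iff)
  then show ?thesis using assms by (simp add: card_inj_on_le finite_set_mult)
qed

lemma set_mult_one_right: "A \<subseteq> carrier G \<Longrightarrow> A <#> {\<one>} = A"
  by (force simp: set_mult_def)

lemma set_inv_set_mult:
  assumes "S \<subseteq> carrier G" "T \<subseteq> carrier G"
  shows "set_inv (S <#> T) = set_inv T <#> set_inv S"
  using assms by (force simp: set_mult_def SET_INV_def inv_mult_group subset_iff)

text \<open>The factor \<open>P\<close> stays on the left while the copies of \<open>S\<close> next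
  to it are stripped off one by one, each at the cost of a factor \<open>c\<close>.\<close>

lemma card_iterated_set_mult_le:
  fixes c :: real
  assumes S: "S \<subseteq> carrier G" "finite S" and c: "c \<ge> 0"
    and step: "\<And>Y. Y \<subseteq> carrier G \<Longrightarrow> finite Y \<Longrightarrow> card (P <#> (S <#> Y)) \<le> c * card (P <#> Y)"
    and Y: "Y \<subseteq> carrier G" "finite Y"
  shows "card (P <#> (((<#>) S ^^ k) Y)) \<le> c ^ k * card (P <#> Y)"
proof (induction k)
  case (Suc k)
  have "((<#>) S ^^ k) Y \<subseteq> carrier G \<and> finite (((<#>) S ^^ k) Y)"
    by (induction k) (use S Y in \<open>auto simp: finite_set_mult set_mult_closed\<close>)
  then have "card (P <#> (((<#>) S ^^ Suc k) Y)) \<le> c * card (P <#> (((<#>) S ^^ k) Y))"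
    using step by simp
  also have "\<dots> \<le> c * (c ^ k * card (P <#> Y))" using Suc c by (rule mult_left_mono)
  finally show ?case by simp
qed simp

end

section \<open>The approximate subgroup and its constants\<close>

text \<open>Reduces each comparison of constants to a comparison of exponents.\<close>

lemma two_power_mult_power_mono:
  fixes a :: real
  assumes "1 \<le> a" "i \<le> i'" "j \<le> j'"
  shows "2 ^ i * a ^ j \<le> 2 ^ i' * a ^ j'"
  by (rule mult_mono) (use assms in \<open>auto intro: power_increasing\<close>)

theorem theorem2p1:
  fixes G :: "('a, 'b) monoid_scheme" and \<alpha> :: real and A B :: "'a set"
  assumes "group G" and "finite (carrier G)"
    and "\<alpha> \<ge> 1"
    and "A \<subseteq> carrier G" and "A \<noteq> {}"
    and "B \<subseteq> carrier G" and "B \<noteq> {}"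
    and "normalized_energy G A B \<ge> inverse \<alpha>"
  shows "\<exists>(\<beta>1 :: real) (\<beta>2 :: real) (\<beta>3 :: real) (\<beta>4 :: real).
    1 \<le> \<beta>1 \<and> 1 \<le> \<beta>2 \<and> 1 \<le> \<beta>3 \<and> 1 \<le> \<beta>4 \<and>
    \<beta>1 \<le> 2 ^ 1861 * \<alpha> ^ 720 \<and>
    \<beta>2 \<le> 2 ^ 325 * \<alpha> ^ 126 \<and>
    \<beta>3 \<le> 2 ^ 2424 * \<alpha> ^ 937 \<and>
    \<beta>4 \<le> 2 ^ 930 * \<alpha> ^ 360 \<and>
    (\<exists>H x y. approximate_subgroup G \<beta>1 H \<and> x \<in> carrier G \<and> y \<in> carrier G \<and>
       real (card H) \<le> \<beta>2 * real (card A) \<and>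
       \<beta>2 * real (card A) \<le> \<beta>2 * \<alpha> ^ 2 * real (card B) \<and>
       real (card (A \<inter> (x <#\<^bsub>G\<^esub> H))) \<ge> inverse \<beta>3 * real (card A) \<and>
       real (card (B \<inter> (H #>\<^bsub>G\<^esub> y))) \<ge> inverse \<beta>3 * real (card B) \<and>
       real (card (H <#>\<^bsub>G\<^esub> H <#>\<^bsub>G\<^esub> H)) / real (card H) \<le> \<beta>4)"
proof -
  interpret group G by fact
  note \<alpha> = \<open>\<alpha> \<ge> 1\<close>
  have A: "A \<subseteq> carrier G" "finite A" "A \<noteq> {}" and B: "B \<subseteq> carrier G" "finite B" "B \<noteq> {}"
    using assms finite_subset by blast+
  define s where "s = sqrt (real (card A) * real (card B))"
  have s2: "s\<^sup>2 = real (card A) * real (card B)" by (simp add: s_def)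
  have sA: "s \<le> \<alpha> * card A" and AB: "card A \<le> \<alpha>\<^sup>2 * card B"
    using normalized_energy_ge_imp[OF A(1) B(1) A(2) B(2) A(3) B(3)] assms by (simp_all add: s_def)
  obtain P Q where "P \<subseteq> A" "Q \<subseteq> B" "card A \<le> 12 * \<alpha> * card P" "card B \<le> 8 * \<alpha> * card Q"
    and PQ: "card (P <#>\<^bsub>G\<^esub> Q) \<le> 2 ^ 20 * \<alpha> ^ 8 * s"
    by (rule balog_szemeredi_gowers[OF A B \<alpha> assms(8), folded s_def])
  then have P: "P \<subseteq> A" "card A \<le> 12 * \<alpha> * card P" and Q: "Q \<subseteq> B" "card B \<le> 8 * \<alpha> * card Q"
    by auto
  have P0: "P \<noteq> {}" "P \<subseteq> carrier G" "finite P" and Q0: "Q \<noteq> {}" "Q \<subseteq> carrier G" "finite Q"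
    using P Q A B finite_subset by (auto simp: card_gt_0_iff)
  define p q where "p = real (card P)" and "q = real (card Q)"
  have p: "p > 0" and q: "q > 0" using P0 Q0 by (simp_all add: p_def q_def card_gt_0_iff)

  \<comment> \<open>The geometric mean \<open>s\<close> is traded for \<open>p\<close> through
    \<open>s \<le> \<alpha> * card A\<close>, with 12 rounded up to 16.\<close>
  have PQp: "card (P <#>\<^bsub>G\<^esub> Q) \<le> 2 ^ 24 * \<alpha> ^ 10 * p"
  proof -
    have "\<alpha> * card A \<le> \<alpha> * (12 * \<alpha> * p)"
      using P(2) \<alpha> by (intro mult_left_mono) (auto simp: p_def)
    also have "\<dots> \<le> 16 * \<alpha>\<^sup>2 * p" using \<alpha> p by (simp add: power2_eq_square)
    finally have "s \<le> 16 * \<alpha>\<^sup>2 * p" using sA by linarith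
    then have "2 ^ 20 * \<alpha> ^ 8 * s \<le> 2 ^ 20 * \<alpha> ^ 8 * (16 * \<alpha>\<^sup>2 * p)"
      using \<alpha> by (intro mult_left_mono) auto
    also have "\<dots> = 2 ^ 24 * (\<alpha> ^ 8 * \<alpha>\<^sup>2) * p" by simp
    also have "\<dots> = 2 ^ 24 * \<alpha> ^ 10 * p" by (simp flip: power_add)
    finally show ?thesis using PQ by linarith
  qed

  \<comment> \<open>The triangle inequality gives \<open>96 * 2 ^ 40 * \<alpha> ^ 18\<close>, and 96
    is rounded up to \<open>2 ^ 7\<close>.\<close>
  define K where "K = 2 ^ 47 * \<alpha> ^ 18"
  have K1: "K \<ge> 1"
    using two_power_mult_power_mono[OF \<alpha>, of 0 47 0 18] by (simp add: K_def)
  have K_power: "2 ^ i * K ^ j * \<alpha> ^ k = 2 ^ (i + 47 * j) * \<alpha> ^ (18 * j + k)" for i j k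
    by (simp add: K_def power_mult_distrib power_add power_mult)
  have "card (P <#>\<^bsub>G\<^esub> set_inv\<^bsub>G\<^esub> P) \<le> K * card P"
  proof -
    have "q * card (P <#>\<^bsub>G\<^esub> set_inv\<^bsub>G\<^esub> P) \<le> (real (card (P <#>\<^bsub>G\<^esub> Q)))\<^sup>2"
      using ruzsa_triangle[OF P0(2,3) Q0(2,3)] unfolding q_def
      by (metis of_nat_le_iff of_nat_mult of_nat_power)
    also have "\<dots> \<le> (2 ^ 20 * \<alpha> ^ 8 * s)\<^sup>2" using PQ by (intro power_mono) auto
    also have "\<dots> = 2 ^ 40 * \<alpha> ^ 16 * (real (card A) * real (card B))"
      by (simp add: power_mult_distrib s2 flip: power_mult)
    also have "\<dots> \<le> 2 ^ 40 * \<alpha> ^ 16 * ((12 * \<alpha> * p) * (8 * \<alpha> * q))"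
      using P Q \<alpha> p q by (intro mult_left_mono mult_mono) (auto simp: p_def q_def)
    also have "\<dots> = q * ((96 * 2 ^ 40) * \<alpha> ^ 18 * p)"
      by (simp add: eval_nat_numeral)
    also have "\<dots> \<le> q * (K * p)"
      using \<alpha> p q unfolding K_def by (intro mult_left_mono mult_right_mono) auto
    finally show ?thesis using q by (simp add: p_def)
  qed
  then obtain S where S: "S \<subseteq> carrier G" "finite S" "\<one>\<^bsub>G\<^esub> \<in> S" "set_inv\<^bsub>G\<^esub> S = S" and pS: "card P \<le> 2 * K * card S"
    and step: "\<And>Y. Y \<subseteq> carrier G \<Longrightarrow> finite Y \<Longrightarrow> card (P <#>\<^bsub>G\<^esub> (S <#>\<^bsub>G\<^esub> Y)) \<le> 2 * K\<^sup>2 * card (P <#>\<^bsub>G\<^esub> Y)"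
    using popular_quotients[OF P0(2,3,1)] by metis
  have S0: "S \<noteq> {}" "card S > 0" using S by (auto simp: card_gt_0_iff)
  \<comment> \<open>The \<open>k\<close>-fold product set of \<open>S\<close>, with the trivial
    subgroup for \<open>k = 0\<close>.\<close>
  define pw where "pw k = ((<#>\<^bsub>G\<^esub>) S ^^ k) {\<one>\<^bsub>G\<^esub>}" for k
  have pw: "pw k \<subseteq> carrier G" "finite (pw k)" for k
    by (induction k) (use S in \<open>auto simp: pw_def finite_set_mult set_mult_closed\<close>)
  have P_pw: "card (P <#>\<^bsub>G\<^esub> pw k) \<le> (2 * K\<^sup>2) ^ k * p" for k
    using card_iterated_set_mult_le[OF S(1,2) _ step, of "{\<one>\<^bsub>G\<^esub>}" k] P0
    by (simp add: pw_def p_def set_mult_one_right)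
  have pw_le: "card (pw k) \<le> (2 * K\<^sup>2) ^ k * p" for k
    using card_le_card_set_mult[OF P0(2,1,3) pw[of k]] P_pw[of k] by linarith
  have pw_le_S: "card (pw k) \<le> 2 ^ Suc k * K ^ Suc (2 * k) * card S" for k
  proof -
    have "(2 * K\<^sup>2) ^ k * p \<le> (2 * K\<^sup>2) ^ k * (2 * K * card S)"
      using pS by (intro mult_left_mono) (auto simp: p_def)
    also have "\<dots> = 2 ^ Suc k * K ^ Suc (2 * k) * card S"
      by (simp add: power_mult_distrib power_mult)
    finally show ?thesis using pw_le[of k] by linarith
  qed

  define H where "H = S <#>\<^bsub>G\<^esub> S"
  have H: "H \<subseteq> carrier G" "finite H" using S by (simp_all add: H_def set_mult_closed finite_set_mult)
  have "S \<subseteq> H" using S by (force simp: H_def set_mult_def)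
  then have SH: "card S \<le> card H" using H by (simp add: card_mono)
  have invH: "set_inv\<^bsub>G\<^esub> H = H" using S by (simp add: H_def set_inv_set_mult)
  have H_pw: "H = pw 2" "H <#>\<^bsub>G\<^esub> H <#>\<^bsub>G\<^esub> S = pw 5" "H <#>\<^bsub>G\<^esub> H <#>\<^bsub>G\<^esub> H = pw 6"
    using S by (simp_all add: H_def pw_def eval_nat_numeral set_mult_one_right set_mult_assoc set_mult_closed)

  \<comment> \<open>All four constants take their largest permitted values; the bounds proved below
    have smaller exponents, for instance 524 and 198 against 1861 and 720 here.\<close>
  define \<beta>1 where "\<beta>1 = 2 ^ 1861 * \<alpha> ^ 720"
  define \<beta>2 where "\<beta>2 = 2 ^ 325 * \<alpha> ^ 126"
  define \<beta>3 where "\<beta>3 = 2 ^ 2424 * \<alpha> ^ 937"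
  define \<beta>4 where "\<beta>4 = 2 ^ 930 * \<alpha> ^ 360"
  have \<beta>: "1 \<le> \<beta>1" "1 \<le> \<beta>2" "1 \<le> \<beta>3" "1 \<le> \<beta>4"
    unfolding \<beta>1_def \<beta>2_def \<beta>3_def \<beta>4_def
    using two_power_mult_power_mono[OF \<alpha> le0 le0] by (simp_all only: power_0 mult_1)

  have "approximate_subgroup G \<beta>1 H"
  proof -
    have "H <#>\<^bsub>G\<^esub> H \<subseteq> carrier G" "finite (H <#>\<^bsub>G\<^esub> H)" "set_inv\<^bsub>G\<^esub> (H <#>\<^bsub>G\<^esub> H) = H <#>\<^bsub>G\<^esub> H"
      using H invH by (simp_all add: set_mult_closed finite_set_mult set_inv_set_mult)
    \<comment> \<open>Covering with respect to \<open>S\<close> rather than \<open>H\<close> is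
      deliberate: the lemma covers by translates of \<open>S <#> S\<close>, which is
      \<open>H\<close> itself.\<close>
    then obtain X where X: "X \<subseteq> H <#>\<^bsub>G\<^esub> H" "set_inv\<^bsub>G\<^esub> X = X" "card X * card S \<le> 2 * card (H <#>\<^bsub>G\<^esub> H <#>\<^bsub>G\<^esub> S)"
      "H <#>\<^bsub>G\<^esub> H \<subseteq> X <#>\<^bsub>G\<^esub> (S <#>\<^bsub>G\<^esub> S)"
      by (rule symmetric_covering[OF S(1,2) S0(1) S(4)])
    have "real (card X) * card S \<le> 2 * real (card (pw 5))"
      using X(3) H_pw(2) by (simp flip: of_nat_mult)
    also have "\<dots> \<le> (2 ^ 7 * K ^ 11 * \<alpha> ^ 0) * card S"
      using pw_le_S[of 5] by (simp add: mult_ac)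
    finally have "card X \<le> 2 ^ 7 * K ^ 11 * \<alpha> ^ 0" using S0 by simp
    also have "\<dots> \<le> \<beta>1"
      unfolding K_power \<beta>1_def by (rule two_power_mult_power_mono[OF \<alpha>]) auto
    finally have "card X \<le> \<beta>1" .
    moreover have "finite X" by (rule finite_subset[OF X(1)]) (simp add: finite_set_mult H)
    ultimately show ?thesis
      using X \<beta> H \<open>S \<subseteq> H\<close> S(3) invH unfolding approximate_subgroup_def H_def by blast
  qed
  moreover have "card H \<le> \<beta>2 * card A"
  proof -
    have "card H \<le> (2 * K\<^sup>2) ^ 2 * p" using pw_le[of 2] by (simp add: H_pw(1))
    also have "\<dots> = (2 ^ 2 * K ^ 4 * \<alpha> ^ 0) * p" by (simp add: power_mult_distrib)
    also have "\<dots> \<le> \<beta>2 * p"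
      unfolding K_power \<beta>2_def using p
      by (intro mult_right_mono two_power_mult_power_mono[OF \<alpha>]) auto
    also have "\<dots> \<le> \<beta>2 * card A"
      using P(1) A \<beta> by (intro mult_left_mono) (auto simp: p_def card_mono)
    finally show ?thesis .
  qed
  moreover have "\<beta>2 * card A \<le> \<beta>2 * \<alpha> ^ 2 * card B"
    using AB \<beta> by (simp add: mult.assoc)
  moreover have "card (H <#>\<^bsub>G\<^esub> H <#>\<^bsub>G\<^esub> H) / card H \<le> \<beta>4"
  proof -
    have "card (H <#>\<^bsub>G\<^esub> H <#>\<^bsub>G\<^esub> H) \<le> (2 ^ 7 * K ^ 13 * \<alpha> ^ 0) * card S"
      using pw_le_S[of 6] by (simp add: H_pw(3))
    also have "\<dots> \<le> \<beta>4 * card S"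
      unfolding K_power \<beta>4_def by (intro mult_right_mono two_power_mult_power_mono[OF \<alpha>]) auto
    also have "\<dots> \<le> \<beta>4 * card H" using SH \<beta> by (intro mult_left_mono) auto
    finally show ?thesis using SH S0 by (simp add: divide_le_eq)
  qed
  moreover obtain x where "x \<in> carrier G" "card (A \<inter> (x <#\<^bsub>G\<^esub> H)) \<ge> inverse \<beta>3 * card A"
  proof -
    obtain x where x: "x \<in> carrier G" "p * card S \<le> real (card (P <#>\<^bsub>G\<^esub> S)) * card (P \<inter> (x <#\<^bsub>G\<^esub> S))"
      using large_left_translate[OF P0(2,3,1) S(1,2) S0(1) S(4)] unfolding p_def by metis
    define c where "c = real (card (A \<inter> (x <#\<^bsub>G\<^esub> H)))"
    \<comment> \<open>The translate is found for the smaller sets \<open>P\<close> and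
      \<open>S\<close> and passes to \<open>A\<close> and \<open>H\<close> by inclusion.\<close>
    have "P \<inter> (x <#\<^bsub>G\<^esub> S) \<subseteq> A \<inter> (x <#\<^bsub>G\<^esub> H)"
      using P \<open>S \<subseteq> H\<close> by (auto simp: l_coset_def)
    then have c: "card (P \<inter> (x <#\<^bsub>G\<^esub> S)) \<le> c" using A by (simp add: c_def card_mono)
    have "p * card S \<le> (2 * K\<^sup>2 * p) * c"
      using P_pw[of 1] S c p by (intro order.trans[OF x(2)] mult_mono) (auto simp: pw_def set_mult_one_right)
    then have "card S \<le> 2 * K\<^sup>2 * c" using p by (simp add: algebra_simps)
    then have "2 * K * card S \<le> 2 * K * (2 * K\<^sup>2 * c)" using K1 by (intro mult_left_mono) auto
    then have "p \<le> 4 * K ^ 3 * c"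
      using pS by (simp add: p_def power3_eq_cube power2_eq_square)
    then have "12 * \<alpha> * p \<le> 12 * \<alpha> * (4 * K ^ 3 * c)" using \<alpha> by (intro mult_left_mono) auto
    also have "\<dots> \<le> (2 ^ 6 * K ^ 3 * \<alpha> ^ 1) * c"
      using \<alpha> K1 by (simp add: c_def mult_right_mono)
    also have "\<dots> \<le> \<beta>3 * c"
      unfolding K_power \<beta>3_def by (intro mult_right_mono two_power_mult_power_mono[OF \<alpha>]) (auto simp: c_def)
    finally have "card A \<le> \<beta>3 * c" using P by (simp add: p_def)
    then show ?thesis using that x(1) \<beta> by (simp add: c_def field_simps)
  qed
  moreover obtain y where "y \<in> carrier G" "card (B \<inter> (H #>\<^bsub>G\<^esub> y)) \<ge> inverse \<beta>3 * card B"
  proof -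
    obtain y where y: "y \<in> carrier G" "q * card S \<le> real (card (S <#>\<^bsub>G\<^esub> Q)) * card (Q \<inter> (S #>\<^bsub>G\<^esub> y))"
      using large_right_translate[OF Q0(2,3,1) S(1,2) S0(1) S(4)] unfolding q_def by metis
    define c where "c = real (card (B \<inter> (H #>\<^bsub>G\<^esub> y)))"
    have "Q \<inter> (S #>\<^bsub>G\<^esub> y) \<subseteq> B \<inter> (H #>\<^bsub>G\<^esub> y)"
      using Q \<open>S \<subseteq> H\<close> by (auto simp: r_coset_def)
    then have c: "card (Q \<inter> (S #>\<^bsub>G\<^esub> y)) \<le> c" using B by (simp add: c_def card_mono)
    \<comment> \<open>The inequality \<open>step\<close> needs \<open>P\<close> on the left, so
      \<open>P\<close> is inserted first; afterwards \<open>P <#> Q\<close> is bounded by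
      \<open>p\<close>, and \<open>p\<close> by \<open>card S\<close>.\<close>
    have "card (S <#>\<^bsub>G\<^esub> Q) \<le> card (P <#>\<^bsub>G\<^esub> (S <#>\<^bsub>G\<^esub> Q))"
      using S P0 Q0 by (intro card_le_card_set_mult) (auto simp: set_mult_closed finite_set_mult)
    also have "real \<dots> \<le> 2 * K\<^sup>2 * card (P <#>\<^bsub>G\<^esub> Q)" using step Q0 by simp
    also have "\<dots> \<le> 2 * K\<^sup>2 * (2 ^ 24 * \<alpha> ^ 10 * p)"
      using PQp by (intro mult_left_mono) auto
    also have "\<dots> \<le> 2 * K\<^sup>2 * (2 ^ 24 * \<alpha> ^ 10 * (2 * K * card S))"
      using pS \<alpha> by (intro mult_left_mono) (auto simp: p_def)
    also have "\<dots> = 2 ^ 26 * K ^ 3 * \<alpha> ^ 10 * card S"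
      by (simp add: power3_eq_cube power2_eq_square)
    finally have "card (S <#>\<^bsub>G\<^esub> Q) \<le> 2 ^ 26 * K ^ 3 * \<alpha> ^ 10 * card S" by simp
    then have "q * card S \<le> (2 ^ 26 * K ^ 3 * \<alpha> ^ 10 * card S) * c"
      using c K1 \<alpha> by (intro order.trans[OF y(2)] mult_mono) auto
    then have "q \<le> 2 ^ 26 * K ^ 3 * \<alpha> ^ 10 * c" using S0 by (simp add: mult_ac)
    then have "8 * \<alpha> * q \<le> 8 * \<alpha> * (2 ^ 26 * K ^ 3 * \<alpha> ^ 10 * c)"
      using \<alpha> by (intro mult_left_mono) auto
    also have "\<dots> = (2 ^ 29 * K ^ 3 * \<alpha> ^ 11) * c"
      by (simp add: eval_nat_numeral)
    also have "\<dots> \<le> \<beta>3 * c"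
      unfolding K_power \<beta>3_def by (intro mult_right_mono two_power_mult_power_mono[OF \<alpha>]) (auto simp: c_def)
    finally have "card B \<le> \<beta>3 * c" using Q by (simp add: q_def)
    then show ?thesis using that y(1) \<beta> by (simp add: c_def field_simps)
  qed
  ultimately show ?thesis
    using \<beta> unfolding \<beta>1_def[symmetric] \<beta>2_def[symmetric] \<beta>3_def[symmetric] \<beta>4_def[symmetric] by blast
qed

end
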